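(* Assume Jensen's principle $\diamondsuit$. Then for every invariant $(A,B,E)$ the principle $\Phi(A,B,E)$ holds.
   Context: An invariant is a triple $(A,B,E)$ such that: (1) $A$ and $B$ are sets of cardinality at most $|\mathbb{R}|$; (2) $E\subseteq A\times B$; (3) for every $a\in A$ there is $b\in B$ with $(a,b)\in E$; (4) for every $b\in B$ there is $a\in A$ with $(a,b)\notin E$. One writes $a\,E\,b$ for $(a,b)\in E$. $2^{<\omega_1}$ is the set of all functions from a countable ordinal into $2=\{0,1\}$. $\Phi(A,B,E)$ is the statement: for every $F:2^{<\omega_1}\to A$ there is $g:\omega_1\to B$ such that for every $f:\omega_1\to 2$ the set $\{\alpha\in\omega_1: F(f\restriction\alpha)\,E\,g(\alpha)\}$ is stationary in $\omega_1$. $\diamondsuit$ is the statement: there is a sequence $A_\alpha$ ($\alpha<\omega_1$) with $A_\alpha\subseteq\alpha$ such that for every $X\subseteq\omega_1$ the set $\{\alpha<\omega_1: X\cap\alpha=A_\alpha\}$ is stationary. *)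

theory Defs
  imports Complex_Main "HOL-Library.Equipollence" "HOL-Library.Countable_Set_Type" "HOL-Library.FuncSet"
begin

unbundle cardinal_syntax

lemma infinite_Field_cardSuc_natLeq: "infinite (Field (cardSuc natLeq))"
  using cardSuc_finite[OF natLeq_Card_order] by (simp add: Field_natLeq)

text \<open>
  The successor cardinal of \<open>\<aleph>\<^sub>0\<close>, made into a type. An ordinal \<open>\<alpha> < \<omega>\<^sub>1\<close>
  is an element of this type; as a set of ordinals it is \<open>{..<\<alpha>}\<close>.
\<close>

typedef omega1 = "Field (cardSuc natLeq)"
proof -
  have "Field (cardSuc natLeq) \<noteq> {}"
    using infinite_Field_cardSuc_natLeq by (metis finite.emptyI)
  then show ?thesis by blast
qed

lemma Well_order_cardSuc_natLeq: "Well_order (cardSuc natLeq)"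
  using cardSuc_Card_order[OF natLeq_Card_order] by (rule card_order_on_well_order_on)

instantiation omega1 :: wellorder
begin

definition less_eq_omega1 :: "omega1 \<Rightarrow> omega1 \<Rightarrow> bool" where
  "\<alpha> \<le> \<beta> \<longleftrightarrow> (Rep_omega1 \<alpha>, Rep_omega1 \<beta>) \<in> cardSuc natLeq"

definition less_omega1 :: "omega1 \<Rightarrow> omega1 \<Rightarrow> bool" where
  "\<alpha> < \<beta> \<longleftrightarrow> \<alpha> \<le> \<beta> \<and> \<alpha> \<noteq> (\<beta> :: omega1)"

instance
proof
  have lin: "Linear_order (cardSuc natLeq)" and wf: "wf (cardSuc natLeq - Id)"
    using Well_order_cardSuc_natLeq by (auto simp: well_order_on_def)
  have rfl: "Refl (cardSuc natLeq)" and tra: "trans (cardSuc natLeq)"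
    and asym: "antisym (cardSuc natLeq)" and tot: "Total (cardSuc natLeq)"
    using lin by (auto simp: order_on_defs)
  fix x y z :: omega1
  show refl: "x \<le> x"
    unfolding less_eq_omega1_def using rfl Rep_omega1[of x] by (auto simp: refl_on_def)
  show anti: "x \<le> y \<Longrightarrow> y \<le> x \<Longrightarrow> x = y"
    unfolding less_eq_omega1_def using asym by (meson Rep_omega1_inject antisymD)
  show "(x < y) = (x \<le> y \<and> \<not> y \<le> x)"
    unfolding less_omega1_def using refl anti by blast
  show "x \<le> y \<Longrightarrow> y \<le> z \<Longrightarrow> x \<le> z"
    unfolding less_eq_omega1_def using tra by (meson transD)
  show "x \<le> y \<or> y \<le> x"
    unfolding less_eq_omega1_def
    using tot rfl Rep_omega1[of x] Rep_omega1[of y]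
    by (cases "Rep_omega1 x = Rep_omega1 y") (auto simp: total_on_def refl_on_def)
  fix P and a :: omega1
  assume step: "\<And>x. (\<And>y. y < x \<Longrightarrow> P y) \<Longrightarrow> P (x :: omega1)"
  have "wf (inv_image (cardSuc natLeq - Id) Rep_omega1)" using wf by (rule wf_inv_image)
  then show "P a"
  proof (induction a rule: wf_induct_rule)
    case (less x)
    show ?case
      by (rule step, rule less)
        (auto simp: less_omega1_def less_eq_omega1_def in_inv_image Rep_omega1_inject)
  qed
qed

end

lemma countable_omega1_segment: "countable {..<\<alpha> :: omega1}"
proof -
  let ?r = "cardSuc natLeq"
  have "Rep_omega1 ` {..<\<alpha>} \<subseteq> underS ?r (Rep_omega1 \<alpha>)"
    by (auto simp: underS_def less_omega1_def less_eq_omega1_def Rep_omega1_inject)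
  moreover have "|underS ?r (Rep_omega1 \<alpha>)| <o ?r"
    by (rule card_of_underS[OF cardSuc_Card_order[OF natLeq_Card_order] Rep_omega1])
  then have "|underS ?r (Rep_omega1 \<alpha>)| \<le>o natLeq"
    using cardSuc_ordLeq_ordLess[OF natLeq_Card_order card_of_Card_order] by blast
  then have "countable (underS ?r (Rep_omega1 \<alpha>))"
    by (simp add: countable_card_le_natLeq)
  ultimately have "countable (Rep_omega1 ` {..<\<alpha>})" using countable_subset by blast
  then show ?thesis by (rule countable_image_inj_on) (auto simp: inj_on_def Rep_omega1_inject)
qed

lemma uncountable_omega1: "uncountable (UNIV :: omega1 set)"
proof
  assume "countable (UNIV :: omega1 set)"
  then have "countable (range Rep_omega1)" by blast
  then have "countable (Field (cardSuc natLeq))"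
    by (simp add: type_definition.Rep_range[OF type_definition_omega1])
  then have "|Field (cardSuc natLeq)| \<le>o natLeq"
    by (simp add: countable_card_le_natLeq)
  moreover have "cardSuc natLeq =o |Field (cardSuc natLeq)|"
    using card_of_Field_ordIso[OF cardSuc_Card_order[OF natLeq_Card_order]] ordIso_symmetric
    by blast
  ultimately have "cardSuc natLeq \<le>o natLeq" using ordIso_ordLeq_trans by blast
  moreover have "natLeq <o cardSuc natLeq" using cardSuc_greater natLeq_Card_order by blast
  ultimately show False using not_ordLess_ordLeq by blast
qed

text \<open>The condition \<open>{..<\<delta>} \<noteq> {}\<close> excludes \<open>\<delta> = 0\<close>.\<close>

definition limit_point :: "omega1 set \<Rightarrow> omega1 \<Rightarrow> bool" where
  "limit_point C \<delta> \<longleftrightarrow> {..<\<delta>} \<noteq> {} \<and> (\<forall>\<beta><\<delta>. \<exists>\<gamma>\<in>C. \<beta> < \<gamma> \<and> \<gamma> < \<delta>)"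

definition club :: "omega1 set \<Rightarrow> bool" where
  "club C \<longleftrightarrow> (\<forall>\<beta>. \<exists>\<gamma>\<in>C. \<beta> < \<gamma>) \<and> (\<forall>\<delta>. limit_point C \<delta> \<longrightarrow> \<delta> \<in> C)"

definition stationary :: "omega1 set \<Rightarrow> bool" where
  "stationary S \<longleftrightarrow> (\<forall>C. club C \<longrightarrow> S \<inter> C \<noteq> {})"

definition diamond :: bool where
  "diamond \<longleftrightarrow> (\<exists>A :: omega1 \<Rightarrow> omega1 set.
     (\<forall>\<alpha>. A \<alpha> \<subseteq> {..<\<alpha>}) \<and>
     (\<forall>X. stationary {\<alpha>. X \<inter> {..<\<alpha>} = A \<alpha>}))"

definition invariant :: "'a set \<Rightarrow> 'b set \<Rightarrow> ('a \<times> 'b) set \<Rightarrow> bool" where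
  "invariant A B E \<longleftrightarrow>
     A \<lesssim> (UNIV :: real set) \<and> B \<lesssim> (UNIV :: real set) \<and>
     E \<subseteq> A \<times> B \<and>
     (\<forall>a\<in>A. \<exists>b\<in>B. (a, b) \<in> E) \<and>
     (\<forall>b\<in>B. \<exists>a\<in>A. (a, b) \<notin> E)"

text \<open>
  The set \<open>2\<^bsup><\<omega>\<^sub>1\<^esup>\<close>, with \<open>bool\<close> for \<open>2\<close>: a function \<open>\<alpha> \<rightarrow> 2\<close> is a partial
  function on \<open>\<omega>\<^sub>1\<close> whose domain is exactly \<open>{..<\<alpha>}\<close>. Every countable ordinal is
  such an \<open>{..<\<alpha>}\<close>.
\<close>

definition binary_seqs :: "(omega1 \<rightharpoonup> bool) set" where
  "binary_seqs = {s. \<exists>\<alpha>. dom s = {..<\<alpha>}}"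

definition restr :: "(omega1 \<Rightarrow> bool) \<Rightarrow> omega1 \<Rightarrow> (omega1 \<rightharpoonup> bool)" where
  "restr f \<alpha> = (Some \<circ> f) |` {..<\<alpha>}"

definition Phi :: "'a set \<Rightarrow> 'b set \<Rightarrow> ('a \<times> 'b) set \<Rightarrow> bool" where
  "Phi A B E \<longleftrightarrow>
     (\<forall>F \<in> binary_seqs \<rightarrow> A. \<exists>g \<in> UNIV \<rightarrow> B. \<forall>f :: omega1 \<Rightarrow> bool.
        stationary {\<alpha>. (F (restr f \<alpha>), g \<alpha>) \<in> E})"

end

theory Submission
  imports Defs
begin

text \<open>
  A diamond sequence guesses, at stationarily many \<open>\<alpha>\<close>, the initial segment
  \<open>f\<restriction>\<alpha>\<close> itself, for every \<open>f : \<omega>\<^sub>1 \<rightarrow> 2\<close>: code \<open>f\<close> by the set of points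
  at which it takes the value 1. Hence \<open>g(\<alpha>)\<close> need only answer the single value
  that \<open>F\<close> gives to the guess at \<open>\<alpha>\<close>, and an answer exists because every \<open>a \<in> A\<close>
  has some \<open>b \<in> B\<close> with \<open>a E b\<close>. Wherever the guess is right, \<open>g(\<alpha>)\<close> answers
  \<open>F(f\<restriction>\<alpha>)\<close>.
\<close>

lemma stationary_mono: "stationary S \<Longrightarrow> S \<subseteq> T \<Longrightarrow> stationary T"
  unfolding stationary_def by blast

lemma restr_in_binary_seqs: "restr f \<alpha> \<in> binary_seqs"
proof -
  have "dom (restr f \<alpha>) = {..<\<alpha>}"
    by (auto simp: restr_def restrict_map_def split: if_splits)
  then show ?thesis unfolding binary_seqs_def by blast
qed

lemma restr_cong: "(\<And>\<xi>. \<xi> < \<alpha> \<Longrightarrow> f \<xi> = h \<xi>) \<Longrightarrow> restr f \<alpha> = restr h \<alpha>"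
  by (auto simp: restr_def restrict_map_def)

text \<open>
  The functional form of \<open>\<diamondsuit>\<close>: the guesses are elements of \<open>2\<^bsup><\<omega>\<^sub>1\<^esup>\<close>, the type
  of object to which a colouring \<open>F\<close> applies.
\<close>

lemma diamond_guesses_restrictions:
  assumes diamond
  obtains s where "\<And>\<alpha>. s \<alpha> \<in> binary_seqs" and "\<And>f. stationary {\<alpha>. restr f \<alpha> = s \<alpha>}"
proof -
  from assms obtain D where D: "\<And>X. stationary {\<alpha>. X \<inter> {..<\<alpha>} = D \<alpha>}"
    unfolding diamond_def by blast
  have "stationary {\<alpha>. restr f \<alpha> = restr (\<lambda>\<xi>. \<xi> \<in> D \<alpha>) \<alpha>}" for f
    by (rule stationary_mono[OF D[of "{\<xi>. f \<xi>}"]]) (blast intro: restr_cong)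
  with restr_in_binary_seqs show thesis by (rule that)
qed

theorem proposition2p4:
  fixes A :: "'a set" and B :: "'b set" and E :: "('a \<times> 'b) set"
  assumes diamond
    and "invariant A B E"
  shows "Phi A B E"
  unfolding Phi_def
proof
  fix F assume F: "F \<in> binary_seqs \<rightarrow> A"
  obtain s where s: "\<And>\<alpha>. s \<alpha> \<in> binary_seqs" and guess: "\<And>f. stationary {\<alpha>. restr f \<alpha> = s \<alpha>}"
    using diamond_guesses_restrictions[OF \<open>diamond\<close>] by blast
  have "\<forall>\<alpha>. \<exists>b. b \<in> B \<and> (F (s \<alpha>), b) \<in> E"
    using assms(2) F s unfolding invariant_def by blast
  then obtain g where g: "\<And>\<alpha>. g \<alpha> \<in> B" "\<And>\<alpha>. (F (s \<alpha>), g \<alpha>) \<in> E"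
    by metis
  have "stationary {\<alpha>. (F (restr f \<alpha>), g \<alpha>) \<in> E}" for f
    by (rule stationary_mono[OF guess[of f]]) (auto simp: g(2))
  with g(1) show "\<exists>g\<in>UNIV \<rightarrow> B. \<forall>f. stationary {\<alpha>. (F (restr f \<alpha>), g \<alpha>) \<in> E}"
    by blast
qed

end
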